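(* Let $k \in \mathbb{N}$, $k\ge 1$, let $C_1,\dots,C_k \in \mathbb{Z}$ and $x \in \mathbb{Z}$. Define $$P_k(n;x) = \sum_{j=1}^{k} C_j\,\bigl[\,n^j x^j + U_j(x)\,\bigr], \qquad Q_k(x) = \sum_{j=1}^{k} C_j\, V_j(x),$$ where the polynomials $U_j, V_j$ are as defined in the context. Then for every prime $p$ the series $\sum_{n=0}^{\infty} n!\,P_k(n;x)\,x^n$ converges in $\mathbb{Q}_p$ and $$\sum_{n=0}^{\infty} n!\,P_k(n;x)\,x^n = Q_k(x);$$ in particular the sum is the same integer for all primes $p$.
   Context: $n! = 1\cdot 2\cdots n$ with $0!=1$; $\mathbb{Q}_p$ is the field of $p$-adic numbers. The polynomials $U_j(x), V_j(x) \in \mathbb{Z}[x]$ ($j \ge 1$) are defined recursively by $U_1(x) = x-1$, $V_1(x) = -1$ and, for $k \ge 1$, $$U_{k+1}(x) = x^{k+1} + U_k(x) - \sum_{\ell=1}^{k}\binom{k+1}{\ell} x^{k+1-\ell}\,U_\ell(x), \qquad V_{k+1}(x) = V_k(x) - \sum_{\ell=1}^{k}\binom{k+1}{\ell} x^{k+1-\ell}\,V_\ell(x).$$ (E.g. $U_2(x) = -x^2+3x-1$, $V_2(x) = 2x-1$, $U_3(x) = x^3-7x^2+6x-1$, $V_3(x) = -3x^2+5x-1$.) Equivalently, $U_j(x) = x A_{j-1}(1;x) - A_{j-1}(0;x)$ and $V_j(x) = -A_{j-1}(0;x)$ where $A_{j-1}(n;x)$ is a polynomial in $x$ with coefficients polynomial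 in $n$ satisfying $\sum_{n=0}^{N-1} n!\,[n^j x^j + U_j(x)]x^n = V_j(x) + N!\,x^N A_{j-1}(N;x)$ for all $N\in\mathbb{N}$. *)

theory Defs
  imports "HOL-Algebra.QuotRing" "HOL-Computational_Algebra.Computational_Algebra" Complex_Main
begin

definition padic_abs :: "nat \<Rightarrow> rat \<Rightarrow> real" where
  "padic_abs p q = (if q = 0 then 0 else
     real p powi (int (multiplicity (int p) (snd (quotient_of q)))
                  - int (multiplicity (int p) (fst (quotient_of q)))))"

definition padic_Cauchy :: "nat \<Rightarrow> (nat \<Rightarrow> rat) \<Rightarrow> bool" where
  "padic_Cauchy p s \<longleftrightarrow>
     (\<forall>e>0. \<exists>M. \<forall>m\<ge>M. \<forall>n\<ge>M. padic_abs p (s m - s n) < e)"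

definition padic_Cauchy_ring :: "nat \<Rightarrow> (nat \<Rightarrow> rat) ring" where
  "padic_Cauchy_ring p =
     \<lparr>carrier = {s. padic_Cauchy p s},
      monoid.mult = (\<lambda>s t n. s n * t n), one = (\<lambda>n. 1),
      zero = (\<lambda>n. 0), add = (\<lambda>s t n. s n + t n)\<rparr>"

definition padic_null :: "nat \<Rightarrow> (nat \<Rightarrow> rat) set" where
  "padic_null p = {s. (\<lambda>n. padic_abs p (s n)) \<longlonglongrightarrow> 0}"

text \<open>
  For prime \<open>p\<close>, the field of \<open>p\<close>-adic numbers, constructed as the completion of the rationals
  with respect to \<open>padic_abs p\<close>: Cauchy sequences modulo null sequences.
\<close>

definition padic_field :: "nat \<Rightarrow> (nat \<Rightarrow> rat) set ring" where
  "padic_field p = padic_Cauchy_ring p Quot padic_null p"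

definition padic_of_rat :: "nat \<Rightarrow> rat \<Rightarrow> (nat \<Rightarrow> rat) set" where
  "padic_of_rat p q = padic_null p +>\<^bsub>padic_Cauchy_ring p\<^esub> (\<lambda>n. q)"

abbreviation padic_of_int :: "nat \<Rightarrow> int \<Rightarrow> (nat \<Rightarrow> rat) set" where
  "padic_of_int p z \<equiv> padic_of_rat p (of_int z)"

text \<open>The limit below exists and does not depend on the representative \<open>s\<close> of the class \<open>X\<close>.\<close>

definition padic_norm :: "nat \<Rightarrow> (nat \<Rightarrow> rat) set \<Rightarrow> real" where
  "padic_norm p X = (THE r. \<forall>s\<in>X. (\<lambda>n. padic_abs p (s n)) \<longlonglongrightarrow> r)"

definition padic_sums :: "nat \<Rightarrow> (nat \<Rightarrow> (nat \<Rightarrow> rat) set) \<Rightarrow> (nat \<Rightarrow> rat) set \<Rightarrow> bool" where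
  "padic_sums p f L \<longleftrightarrow>
     (\<forall>n. f n \<in> carrier (padic_field p)) \<and> L \<in> carrier (padic_field p) \<and>
     (\<lambda>N. padic_norm p
        (finsum (padic_field p) f {..<N} \<ominus>\<^bsub>padic_field p\<^esub> L)) \<longlonglongrightarrow> 0"

text \<open>The index \<open>0\<close> is a dummy value; it is never used by the recursion.\<close>

fun U :: "nat \<Rightarrow> int poly" where
  "U 0 = 0"
| "U (Suc 0) = [:-1, 1:]"
| "U (Suc (Suc i)) =
     (let k = Suc i in
      monom 1 (k + 1) + U k
      - (\<Sum>l=1..k. monom (of_nat ((k + 1) choose l)) (k + 1 - l) * U l))"

fun V :: "nat \<Rightarrow> int poly" where
  "V 0 = 0"
| "V (Suc 0) = [:-1:]"
| "V (Suc (Suc i)) =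
     (let k = Suc i in
      V k - (\<Sum>l=1..k. monom (of_nat ((k + 1) choose l)) (k + 1 - l) * V l))"

lemma U_rec:
  assumes "k \<ge> 1"
  shows "U (k + 1) = monom 1 (k + 1) + U k
           - (\<Sum>l=1..k. monom (of_nat ((k + 1) choose l)) (k + 1 - l) * U l)"
  using assms by (cases k) (simp_all only: U.simps Let_def, simp_all)

lemma V_rec:
  assumes "k \<ge> 1"
  shows "V (k + 1) = V k
           - (\<Sum>l=1..k. monom (of_nat ((k + 1) choose l)) (k + 1 - l) * V l)"
  using assms by (cases k) (simp_all only: V.simps Let_def, simp_all)

lemma U_V_examples:
  "U 2 = [:-1, 3, -1:]" "V 2 = [:-1, 2:]"
  "U 3 = [:-1, 6, -7, 1:]" "V 3 = [:-1, 5, -3:]"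
  by (simp_all add: numeral_eq_Suc monom_Suc monom_0)

definition P :: "(nat \<Rightarrow> int) \<Rightarrow> nat \<Rightarrow> nat \<Rightarrow> int \<Rightarrow> int" where
  "P C k n x = (\<Sum>j=1..k. C j * (int n ^ j * x ^ j + poly (U j) x))"

definition Q :: "(nat \<Rightarrow> int) \<Rightarrow> nat \<Rightarrow> int \<Rightarrow> int" where
  "Q C k x = (\<Sum>j=1..k. C j * poly (V j) x)"

end

theory Submission
  imports Defs
begin

text \<open>
  Since \<open>n! x\<^sup>n ((n + 1)\<^sup>k\<^sup>+\<^sup>1 x\<^sup>k\<^sup>+\<^sup>1 - n\<^sup>k x\<^sup>k)\<close> is the forward difference of \<open>n! x\<^sup>n n\<^sup>k x\<^sup>k\<close>,
  the recursion for \<open>U\<close> and \<open>V\<close> is the one that makes the partial sum up to \<open>N\<close> congruent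
  to \<open>V j\<close> modulo \<open>N!\<close>, and \<open>N!\<close> tends to \<open>0\<close> in every \<open>p\<close>-adic topology.
\<close>

section \<open>Partial sums modulo factorials\<close>

text \<open>One factor \<open>n + 1\<close> and one factor \<open>x\<close> are absorbed into the
  next factorial and the next power of \<open>x\<close>, so the sum telescopes. The boundary term at
  \<open>n = 0\<close> vanishes because \<open>0 ^ k = 0\<close> for
  \<open>k \<ge> 1\<close>.\<close>

lemma sum_telescope_fact_power:
  fixes x :: int
  assumes "k \<ge> 1"
  shows "(\<Sum>n<N. fact n * (int (n + 1) ^ (k + 1) * x ^ (k + 1) - int n ^ k * x ^ k) * x ^ n)
           = fact N * x ^ N * (int N ^ k * x ^ k)"
  using assms by (induction N) (auto simp: algebra_simps)

text \<open>Binomial theorem for \<open>int n * x + x\<close>. The end terms \<open>l = 0\<close>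
  and \<open>l = k + 1\<close> are split off so that the remaining sum has the index range and
  coefficients of the recursions for \<open>U\<close> and \<open>V\<close>.\<close>

lemma Suc_power_expand:
  fixes x :: int
  shows "int (n + 1) ^ (k + 1) * x ^ (k + 1)
           = int n ^ (k + 1) * x ^ (k + 1) + x ^ (k + 1)
             + (\<Sum>l=1..k. int ((k + 1) choose l) * x ^ (k + 1 - l) * (int n ^ l * x ^ l))"
proof -
  have "int (n + 1) ^ (k + 1) * x ^ (k + 1) = (int n * x + x) ^ (k + 1)"
    by (simp add: algebra_simps flip: power_mult_distrib)
  also have "\<dots> = (\<Sum>l\<le>k + 1. int ((k + 1) choose l) * x ^ (k + 1 - l) * (int n ^ l * x ^ l))"
    by (subst binomial_ring) (simp add: power_mult_distrib mult_ac)
  also have "{..k + 1} = insert 0 (insert (k + 1) {1..k})"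
    by auto
  finally show ?thesis
    by simp
qed

text \<open>The \<open>x ^ (k + 1)\<close> in the recursion for \<open>U\<close> cancels the
  \<open>l = 0\<close> term of the binomial expansion, and each \<open>U l\<close> pairs with
  \<open>int n ^ l * x ^ l\<close>. Adding and subtracting \<open>int n ^ k * x ^ k\<close> then
  leaves a telescoping part plus brackets of smaller index.\<close>

lemma U_term_rec:
  fixes x :: int
  assumes "k \<ge> 1"
  shows "int n ^ (k + 1) * x ^ (k + 1) + poly (U (k + 1)) x
           = (int (n + 1) ^ (k + 1) * x ^ (k + 1) - int n ^ k * x ^ k)
             + (int n ^ k * x ^ k + poly (U k) x)
             - (\<Sum>l=1..k. int ((k + 1) choose l) * x ^ (k + 1 - l) * (int n ^ l * x ^ l + poly (U l) x))"
  unfolding U_rec[OF assms] Suc_power_expand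
  by (simp add: poly_sum poly_monom distrib_left sum.distrib)

lemma fact_dvd_partial_sum_minus_V:
  fixes x :: int
  assumes "j \<ge> 1"
  shows "fact N dvd (\<Sum>n<N. fact n * (int n ^ j * x ^ j + poly (U j) x) * x ^ n) - poly (V j) x"
  using assms
proof (induction j rule: less_induct)
  case (less j)
  define S where "S i = (\<Sum>n<N. fact n * (int n ^ i * x ^ i + poly (U i) x) * x ^ n)" for i
  show ?case
  proof (cases "j = 1")
    case True
    \<comment> \<open>The summand is the difference of consecutive values of
      \<open>fact n * x ^ n\<close>. Here the boundary term at 0 survives and gives -1, the value of
      \<open>V 1\<close>.\<close>
    have "(\<Sum>n<N. fact n * (int n * x + (x - 1)) * x ^ n) = fact N * x ^ N - 1"
      by (induction N) (auto simp: algebra_simps)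
    with True show ?thesis
      by simp
  next
    case False
    with less.prems obtain k where k: "j = k + 1" "k \<ge> 1"
      by (cases j) auto
    define c where "c l = int ((k + 1) choose l) * x ^ (k + 1 - l)" for l
    have "S j = (\<Sum>n<N. fact n * (int (n + 1) ^ (k + 1) * x ^ (k + 1) - int n ^ k * x ^ k) * x ^ n)
                + S k - (\<Sum>n<N. \<Sum>l=1..k. c l * (fact n * (int n ^ l * x ^ l + poly (U l) x) * x ^ n))"
      unfolding S_def k(1) U_term_rec[OF k(2)] c_def
      by (simp only: sum.distrib[symmetric] sum_subtractf[symmetric])
        (simp only: algebra_simps sum_distrib_left sum_distrib_right)
    also have "(\<Sum>n<N. \<Sum>l=1..k. c l * (fact n * (int n ^ l * x ^ l + poly (U l) x) * x ^ n))
                 = (\<Sum>l=1..k. c l * S l)"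
      unfolding S_def by (subst sum.swap) (simp only: sum_distrib_left)
    finally have S: "S j = fact N * x ^ N * (int N ^ k * x ^ k) + S k - (\<Sum>l=1..k. c l * S l)"
      unfolding sum_telescope_fact_power[OF k(2)] .
    \<comment> \<open>\<open>V\<close> satisfies the recursion found for \<open>S\<close>, but
      without the telescoped term. Subtracting the two leaves that term, a multiple of
      \<open>fact N\<close>, and differences of smaller index covered by the induction
      hypothesis.\<close>
    have V: "poly (V j) x = poly (V k) x - (\<Sum>l=1..k. c l * poly (V l) x)"
      unfolding k(1) V_rec[OF k(2)] c_def by (simp add: poly_sum poly_monom)
    have "S j - poly (V j) x = fact N * x ^ N * (int N ^ k * x ^ k) + (S k - poly (V k) x)
            - (\<Sum>l=1..k. c l * (S l - poly (V l) x))"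
      unfolding S V by (simp add: right_diff_distrib sum_subtractf)
    moreover have "fact N dvd S l - poly (V l) x" if "l \<in> {1..k}" for l
      unfolding S_def using less.IH[of l] that k by auto
    moreover from this[of k] have "fact N dvd S k - poly (V k) x"
      using k(2) by simp
    ultimately have "fact N dvd S j - poly (V j) x"
      by (metis (no_types, lifting) dvd_add dvd_diff dvd_mult dvd_mult2 dvd_refl dvd_sum)
    then show ?thesis
      by (simp only: S_def)
  qed
qed

lemma fact_dvd_partial_sum_minus_Q:
  "fact N dvd (\<Sum>n<N. fact n * P C k n x * x ^ n) - Q C k x"
proof -
  have "(\<Sum>n<N. fact n * P C k n x * x ^ n)
          = (\<Sum>n<N. \<Sum>j=1..k. C j * (fact n * (int n ^ j * x ^ j + poly (U j) x) * x ^ n))"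
    unfolding P_def by (simp only: sum_distrib_left sum_distrib_right mult_ac)
  also have "\<dots> = (\<Sum>j=1..k. C j * (\<Sum>n<N. fact n * (int n ^ j * x ^ j + poly (U j) x) * x ^ n))"
    by (subst sum.swap) (simp only: sum_distrib_left)
  finally have "(\<Sum>n<N. fact n * P C k n x * x ^ n) - Q C k x
      = (\<Sum>j=1..k. C j * ((\<Sum>n<N. fact n * (int n ^ j * x ^ j + poly (U j) x) * x ^ n) - poly (V j) x))"
    by (simp add: Q_def right_diff_distrib sum_subtractf)
  then show ?thesis
    using fact_dvd_partial_sum_minus_V by (auto intro!: dvd_sum dvd_mult)
qed

section \<open>The \<open>p\<close>-adic absolute value\<close>

lemma null_comparison:
  fixes f g :: "nat \<Rightarrow> real"
  assumes "g \<longlonglongrightarrow> 0" "\<And>n. \<bar>f n\<bar> \<le> g n"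
  shows "f \<longlonglongrightarrow> 0"
proof (rule tendsto_0_le[OF assms(1), where K = 1], rule always_eventually, rule allI)
  show "norm (f n) \<le> norm (g n) * 1" for n
    using assms(2)[of n] by simp
qed

context
  fixes p :: nat
  assumes p: "prime p"
begin

lemma padic_abs_0 [simp]: "padic_abs p 0 = 0"
  by (simp add: padic_abs_def)

lemma padic_abs_nonneg [simp]: "padic_abs p q \<ge> 0"
  by (simp add: padic_abs_def)

lemma padic_abs_of_int:
  "padic_abs p (of_int a) = (if a = 0 then 0 else inverse (real p ^ multiplicity (int p) a))"
  by (simp add: padic_abs_def power_int_minus)

lemma padic_abs_of_int_mult:
  "padic_abs p (of_int (a * b)) = padic_abs p (of_int a) * padic_abs p (of_int b)"
proof (cases "a = 0 \<or> b = 0")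
  case False
  with p have "multiplicity (int p) (a * b) = multiplicity (int p) a + multiplicity (int p) b"
    by (intro prime_elem_multiplicity_mult_distrib) auto
  with False show ?thesis
    by (simp only: padic_abs_of_int) (simp add: power_add)
qed auto

lemma padic_abs_of_int_eq_0_iff: "padic_abs p (of_int a) = 0 \<longleftrightarrow> a = 0"
  using p by (auto simp: padic_abs_of_int prime_gt_0_nat)

text \<open>Frees the absolute value from the reduced fraction used in its definition.
  Cross-multiplying with the reduced fraction \<open>c / d\<close> gives
  \<open>a * d = c * b\<close>, and multiplicativity on integers turns this into equality of the two
  quotients of absolute values.\<close>

lemma padic_abs_divide_of_int:
  assumes "b \<noteq> 0"
  shows "padic_abs p (of_int a / of_int b) = padic_abs p (of_int a) / padic_abs p (of_int b)"
proof -
  obtain c d where cd: "quotient_of (of_int a / of_int b) = (c, d)"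
    by force
  then have d: "d > 0" and eq: "of_int a / of_int b = (of_int c / of_int d :: rat)"
    using quotient_of_denom_pos quotient_of_div by blast+
  from eq assms d have "of_int (a * d) = (of_int (c * b) :: rat)"
    by (simp add: field_simps)
  then have "a * d = c * b"
    by (simp only: of_int_eq_iff)
  then have "padic_abs p (of_int a) * padic_abs p (of_int d)
      = padic_abs p (of_int c) * padic_abs p (of_int b)"
    by (simp only: padic_abs_of_int_mult[symmetric])
  moreover have "padic_abs p (of_int a / of_int b) = padic_abs p (of_int c) / padic_abs p (of_int d)"
  proof (cases "a = 0")
    case True
    with \<open>a * d = c * b\<close> assms show ?thesis
      by simp
  next
    case False
    with \<open>a * d = c * b\<close> d assms have "c \<noteq> 0"
      by auto
    then show ?thesis
      using False assms d p cd unfolding padic_abs_of_int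
      by (auto simp: padic_abs_def power_int_diff field_simps)
  qed
  moreover have "padic_abs p (of_int b) \<noteq> 0" "padic_abs p (of_int d) \<noteq> 0"
    using assms d by (simp_all add: padic_abs_of_int_eq_0_iff)
  ultimately show ?thesis
    by (simp add: frac_eq_eq)
qed

lemma padic_abs_mult: "padic_abs p (q * r) = padic_abs p q * padic_abs p r"
proof -
  obtain a b where q: "q = of_int a / of_int b" "b > 0"
    by (metis quotient_of_denom_pos quotient_of_div surj_pair)
  obtain c d where r: "r = of_int c / of_int d" "d > 0"
    by (metis quotient_of_denom_pos quotient_of_div surj_pair)
  have "q * r = of_int (a * c) / of_int (b * d)"
    by (simp add: q r)
  moreover have "b \<noteq> 0" "d \<noteq> 0" "b * d \<noteq> 0"
    using q r by simp_all
  ultimately show ?thesis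
    by (simp only: q(1) r(1) padic_abs_divide_of_int padic_abs_of_int_mult times_divide_times_eq
        not_False_eq_True)
qed

lemma padic_abs_le_if_power_dvd:
  assumes "int p ^ m dvd a"
  shows "padic_abs p (of_int a) \<le> inverse (real p ^ m)"
proof (cases "a = 0")
  case False
  have "\<not> is_unit (int p)"
    using p by (metis nat_int not_prime_unit prime_nat_int_transfer)
  with False assms have "m \<le> multiplicity (int p) a"
    by (intro multiplicity_geI) auto
  with False p show ?thesis
    using prime_ge_1_nat[OF p]
    by (auto simp: padic_abs_of_int prime_gt_0_nat intro!: le_imp_inverse_le power_increasing)
qed (simp)

lemma padic_abs_of_int_add:
  "padic_abs p (of_int (a + b)) \<le> max (padic_abs p (of_int a)) (padic_abs p (of_int b))"
proof (cases "a = 0 \<or> b = 0")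
  case False
  \<comment> \<open>A power of \<open>p\<close> dividing both summands divides their sum. Zero
    summands are set aside beforehand because \<open>multiplicity\<close> assigns 0 to the number 0,
    where the valuation should be infinite.\<close>
  define m where "m = min (multiplicity (int p) a) (multiplicity (int p) b)"
  have "int p ^ m dvd a" "int p ^ m dvd b"
    by (auto simp: m_def intro: multiplicity_dvd')
  then have "padic_abs p (of_int (a + b)) \<le> inverse (real p ^ m)"
    by (intro padic_abs_le_if_power_dvd) auto
  also have "\<dots> \<le> max (padic_abs p (of_int a)) (padic_abs p (of_int b))"
    using False by (auto simp: padic_abs_of_int m_def min_def)
  finally show ?thesis .
qed (auto simp: max_def)

text \<open>The ultrametric inequality: over the common denominator \<open>b * d\<close> it reduces
  to the integer case for the numerators.\<close>

lemma padic_abs_add_le_max: "padic_abs p (q + r) \<le> max (padic_abs p q) (padic_abs p r)"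
proof -
  obtain a b where q: "q = of_int a / of_int b" "b > 0"
    by (metis quotient_of_denom_pos quotient_of_div surj_pair)
  obtain c d where r: "r = of_int c / of_int d" "d > 0"
    by (metis quotient_of_denom_pos quotient_of_div surj_pair)
  have 1: "q = of_int (a * d) / of_int (b * d)" "r = of_int (c * b) / of_int (b * d)"
    using q r by simp_all
  have 2: "q + r = of_int (a * d + c * b) / of_int (b * d)"
    unfolding 1 by (simp only: of_int_add add_divide_distrib)
  have nz: "b * d \<noteq> 0"
    using q r by simp
  have "padic_abs p (q + r) = padic_abs p (of_int (a * d + c * b)) / padic_abs p (of_int (b * d))"
    unfolding 2 using nz by (rule padic_abs_divide_of_int)
  also have "\<dots> \<le> max (padic_abs p (of_int (a * d))) (padic_abs p (of_int (c * b)))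
                    / padic_abs p (of_int (b * d))"
    by (intro divide_right_mono padic_abs_of_int_add) simp
  also have "\<dots> = max (padic_abs p q) (padic_abs p r)"
    unfolding 1 padic_abs_divide_of_int[OF nz] by (simp add: max_divide_distrib_right)
  finally show ?thesis .
qed

lemma padic_abs_add: "padic_abs p (q + r) \<le> padic_abs p q + padic_abs p r"
  by (rule order_trans[OF padic_abs_add_le_max]) simp

lemma padic_abs_minus [simp]: "padic_abs p (- q) = padic_abs p q"
  by (simp add: padic_abs_def rat_uminus_code split: prod.splits)

lemma padic_abs_diff: "padic_abs p (q - r) \<le> padic_abs p q + padic_abs p r"
  using padic_abs_add[of q "- r"] by simp

text \<open>No exact valuation of the factorial is required: once \<open>n \<ge> p ^ m\<close>, the
  number \<open>p ^ m\<close> is itself one of the factors of \<open>fact n\<close>.\<close>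

lemma padic_abs_fact_tendsto_0: "(\<lambda>n. padic_abs p (fact n)) \<longlonglongrightarrow> 0"
proof (rule LIMSEQ_I)
  fix e :: real
  assume "e > 0"
  have "1 < real p"
    using p prime_gt_1_nat by simp
  then have "(\<lambda>m. inverse (real p ^ m)) \<longlonglongrightarrow> 0"
    by (rule LIMSEQ_inverse_realpow_zero)
  with \<open>e > 0\<close> obtain m where m: "inverse (real p ^ m) < e"
    by (metis LIMSEQ_D abs_less_iff diff_zero le_refl real_norm_def)
  have "padic_abs p (fact n) < e" if "n \<ge> p ^ m" for n
  proof -
    have "p ^ m dvd fact n"
      using that p by (intro dvd_fact) (auto simp: Suc_le_eq prime_gt_0_nat)
    then have "int p ^ m dvd fact n"
      by (metis int_dvd_int_iff of_nat_fact of_nat_power)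
    then have "padic_abs p (of_int (fact n)) \<le> inverse (real p ^ m)"
      by (rule padic_abs_le_if_power_dvd)
    with m show ?thesis
      by simp
  qed
  then show "\<exists>N. \<forall>n\<ge>N. norm (padic_abs p (fact n) - 0) < e"
    by (intro exI[of _ "p ^ m"]) simp
qed

lemma padic_abs_le_if_dvd:
  assumes "a dvd b"
  shows "padic_abs p (of_int b) \<le> padic_abs p (of_int a)"
proof -
  from assms obtain c where c: "b = a * c" ..
  \<comment> \<open>The exponent 0 in the divisibility bound shows that integers have absolute value
    at most 1.\<close>
  have "padic_abs p (of_int c) \<le> 1"
    using padic_abs_le_if_power_dvd[of 0 c] by simp
  then show ?thesis
    unfolding c padic_abs_of_int_mult by (intro mult_left_le) auto
qed

section \<open>The ring of Cauchy sequences and its quotient\<close>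

lemma padic_CauchyD:
  assumes "padic_Cauchy p s" "e > 0"
  obtains M where "\<And>m n. m \<ge> M \<Longrightarrow> n \<ge> M \<Longrightarrow> padic_abs p (s m - s n) < e"
  using assms unfolding padic_Cauchy_def by blast

lemma padic_Cauchy_const: "padic_Cauchy p (\<lambda>_. q)"
  by (simp add: padic_Cauchy_def)

lemma padic_Cauchy_add:
  assumes "padic_Cauchy p s" "padic_Cauchy p t"
  shows "padic_Cauchy p (\<lambda>n. s n + t n)"
  unfolding padic_Cauchy_def
proof safe
  fix e :: real
  assume "e > 0"
  obtain M where M: "\<And>m n. m \<ge> M \<Longrightarrow> n \<ge> M \<Longrightarrow> padic_abs p (s m - s n) < e"
    using padic_CauchyD[OF assms(1) \<open>e > 0\<close>] by blast
  obtain N where N: "\<And>m n. m \<ge> N \<Longrightarrow> n \<ge> N \<Longrightarrow> padic_abs p (t m - t n) < e"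
    using padic_CauchyD[OF assms(2) \<open>e > 0\<close>] by blast
  have "padic_abs p (s m + t m - (s n + t n)) < e" if "m \<ge> max M N" "n \<ge> max M N" for m n
    using padic_abs_add_le_max[of "s m - s n" "t m - t n"] M[of m n] N[of m n] that
    by (simp add: algebra_simps)
  then show "\<exists>M. \<forall>m\<ge>M. \<forall>n\<ge>M. padic_abs p (s m + t m - (s n + t n)) < e"
    by blast
qed

lemma padic_Cauchy_bounded:
  assumes "padic_Cauchy p s"
  obtains B where "B > 0" "\<And>n. padic_abs p (s n) \<le> B"
proof -
  obtain M where M: "\<And>m n. m \<ge> M \<Longrightarrow> n \<ge> M \<Longrightarrow> padic_abs p (s m - s n) < 1"
    using padic_CauchyD[OF assms, of 1] by auto
  \<comment> \<open>The sum dominates each of the values up to index \<open>M\<close>; the extra 1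
    is the Cauchy tolerance that covers the later ones.\<close>
  define B where "B = 1 + (\<Sum>n\<le>M. padic_abs p (s n))"
  have le: "padic_abs p (s n) \<le> B - 1" if "n \<le> M" for n
    unfolding B_def using that by (auto intro!: member_le_sum)
  have "padic_abs p (s n) \<le> B" for n
  proof (cases "n \<le> M")
    case False
    have "padic_abs p (s n) \<le> padic_abs p (s n - s M) + padic_abs p (s M)"
      using padic_abs_add[of "s n - s M" "s M"] by simp
    with False M[of n M] le[of M] show ?thesis
      by simp
  qed (use le[of n] in simp)
  moreover have "B > 0"
    unfolding B_def by (intro add_pos_nonneg sum_nonneg) auto
  ultimately show ?thesis
    using that by blast
qed

lemma padic_Cauchy_mult:
  assumes "padic_Cauchy p s" "padic_Cauchy p t"
  shows "padic_Cauchy p (\<lambda>n. s n * t n)"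
  unfolding padic_Cauchy_def
proof safe
  fix e :: real
  assume "e > 0"
  obtain A where A: "A > 0" "\<And>n. padic_abs p (s n) \<le> A"
    using padic_Cauchy_bounded[OF assms(1)] by blast
  obtain B where B: "B > 0" "\<And>n. padic_abs p (t n) \<le> B"
    using padic_Cauchy_bounded[OF assms(2)] by blast
  \<comment> \<open>The tolerances \<open>e / B\<close> and \<open>e / A\<close> fit the splitting
    of the difference of products into \<open>(s m - s n) * t m\<close> and
    \<open>s n * (t m - t n)\<close>, where \<open>B\<close> bounds \<open>t\<close> and
    \<open>A\<close> bounds \<open>s\<close>.\<close>
  obtain M where M: "\<And>m n. m \<ge> M \<Longrightarrow> n \<ge> M \<Longrightarrow> padic_abs p (s m - s n) < e / B"
    using padic_CauchyD[OF assms(1), of "e / B"] \<open>e > 0\<close> B by auto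
  obtain N where N: "\<And>m n. m \<ge> N \<Longrightarrow> n \<ge> N \<Longrightarrow> padic_abs p (t m - t n) < e / A"
    using padic_CauchyD[OF assms(2), of "e / A"] \<open>e > 0\<close> A by auto
  have "padic_abs p (s m * t m - s n * t n) < e" if "m \<ge> max M N" "n \<ge> max M N" for m n
  proof -
    have "padic_abs p (s m * t m - s n * t n)
        \<le> max (padic_abs p ((s m - s n) * t m)) (padic_abs p (s n * (t m - t n)))"
      using padic_abs_add_le_max[of "(s m - s n) * t m" "s n * (t m - t n)"]
      by (simp add: algebra_simps)
    moreover have "padic_abs p (s m - s n) * padic_abs p (t m) \<le> padic_abs p (s m - s n) * B"
      using B by (intro mult_left_mono) auto
    moreover have "padic_abs p (s m - s n) * B < e"
      using M[of m n] that B by (simp add: field_simps)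
    moreover have "padic_abs p (s n) * padic_abs p (t m - t n) \<le> A * padic_abs p (t m - t n)"
      using A by (intro mult_right_mono) auto
    moreover have "A * padic_abs p (t m - t n) < e"
      using N[of m n] that A by (simp add: field_simps)
    ultimately show ?thesis
      by (simp add: padic_abs_mult)
  qed
  then show "\<exists>M. \<forall>m\<ge>M. \<forall>n\<ge>M. padic_abs p (s m * t m - s n * t n) < e"
    by blast
qed

lemma padic_Cauchy_minus:
  assumes "padic_Cauchy p s"
  shows "padic_Cauchy p (\<lambda>n. - s n)"
  using padic_Cauchy_mult[OF padic_Cauchy_const[of "-1"] assms] by simp

lemma cring_padic_Cauchy_ring: "cring (padic_Cauchy_ring p)"
proof (rule cringI)
  show "abelian_group (padic_Cauchy_ring p)"
  proof (rule abelian_groupI)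
    fix s
    assume "s \<in> carrier (padic_Cauchy_ring p)"
    then show "\<exists>t\<in>carrier (padic_Cauchy_ring p).
        t \<oplus>\<^bsub>padic_Cauchy_ring p\<^esub> s = \<zero>\<^bsub>padic_Cauchy_ring p\<^esub>"
      by (intro bexI[of _ "\<lambda>n. - s n"]) (auto simp: padic_Cauchy_ring_def padic_Cauchy_minus)
  qed (auto simp: padic_Cauchy_ring_def padic_Cauchy_add padic_Cauchy_const algebra_simps)
  show "comm_monoid (padic_Cauchy_ring p)"
    by (rule comm_monoidI)
      (auto simp: padic_Cauchy_ring_def padic_Cauchy_mult padic_Cauchy_const algebra_simps)
qed (auto simp: padic_Cauchy_ring_def algebra_simps)

lemma padic_Cauchy_if_null:
  assumes "s \<in> padic_null p"
  shows "padic_Cauchy p s"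
  unfolding padic_Cauchy_def
proof safe
  fix e :: real
  assume "e > 0"
  with assms obtain M where M: "\<And>n. n \<ge> M \<Longrightarrow> padic_abs p (s n) < e / 2"
    unfolding padic_null_def using LIMSEQ_D[of _ 0 "e / 2"] by fastforce
  have "padic_abs p (s m - s n) < e" if "m \<ge> M" "n \<ge> M" for m n
    using padic_abs_diff[of "s m" "s n"] M[of m] M[of n] that by simp
  then show "\<exists>M. \<forall>m\<ge>M. \<forall>n\<ge>M. padic_abs p (s m - s n) < e"
    by blast
qed

lemma padic_null_add:
  assumes "s \<in> padic_null p" "t \<in> padic_null p"
  shows "(\<lambda>n. s n + t n) \<in> padic_null p"
proof -
  have "(\<lambda>n. padic_abs p (s n) + padic_abs p (t n)) \<longlonglongrightarrow> 0"
    using assms tendsto_add[of "\<lambda>n. padic_abs p (s n)" 0] by (auto simp: padic_null_def)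
  then have "(\<lambda>n. padic_abs p (s n + t n)) \<longlonglongrightarrow> 0"
    by (rule null_comparison) (simp add: padic_abs_add)
  then show ?thesis
    by (simp add: padic_null_def)
qed

text \<open>Absorption for the ideal of null sequences: a Cauchy sequence is bounded, and a bounded
  sequence times a null sequence is null.\<close>

lemma padic_null_mult:
  assumes "padic_Cauchy p s" "t \<in> padic_null p"
  shows "(\<lambda>n. s n * t n) \<in> padic_null p"
proof -
  obtain A where A: "A > 0" "\<And>n. padic_abs p (s n) \<le> A"
    using padic_Cauchy_bounded[OF assms(1)] by blast
  have "(\<lambda>n. A * padic_abs p (t n)) \<longlonglongrightarrow> 0"
    using assms(2) by (auto simp: padic_null_def intro: tendsto_mult_right_zero)
  then have "(\<lambda>n. padic_abs p (s n * t n)) \<longlonglongrightarrow> 0"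
    by (rule null_comparison) (use A in \<open>auto simp: padic_abs_mult intro!: mult_right_mono\<close>)
  then show ?thesis
    by (simp add: padic_null_def)
qed

lemma ideal_padic_null: "ideal (padic_null p) (padic_Cauchy_ring p)"
proof -
  interpret cring "padic_Cauchy_ring p"
    by (rule cring_padic_Cauchy_ring)
  \<comment> \<open>Uniqueness of inverses identifies the abstract negation of the ring with the
    pointwise one, as closure of the null sequences under negation requires.\<close>
  have minus: "\<ominus>\<^bsub>padic_Cauchy_ring p\<^esub> s = (\<lambda>n. - s n)" if "padic_Cauchy p s" for s
    using that by (intro minus_equality) (auto simp: padic_Cauchy_ring_def padic_Cauchy_minus)
  show ?thesis
  proof (rule idealI)
    show "ring (padic_Cauchy_ring p)" ..
    show "subgroup (padic_null p) (add_monoid (padic_Cauchy_ring p))"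
    proof (rule add.subgroupI)
      show "padic_null p \<subseteq> carrier (padic_Cauchy_ring p)"
        by (auto simp: padic_Cauchy_ring_def padic_Cauchy_if_null)
      have "(\<lambda>n. 0) \<in> padic_null p"
        by (simp add: padic_null_def)
      then show "padic_null p \<noteq> {}"
        by blast
    next
      fix s
      assume "s \<in> padic_null p"
      then show "\<ominus>\<^bsub>padic_Cauchy_ring p\<^esub> s \<in> padic_null p"
        using minus[OF padic_Cauchy_if_null] by (simp add: padic_null_def)
    next
      fix s t
      assume "s \<in> padic_null p" "t \<in> padic_null p"
      then show "s \<oplus>\<^bsub>padic_Cauchy_ring p\<^esub> t \<in> padic_null p"
        by (simp add: padic_Cauchy_ring_def padic_null_add)
    qed
  next
    fix t s
    assume "t \<in> padic_null p" "s \<in> carrier (padic_Cauchy_ring p)"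
    then have "(\<lambda>n. s n * t n) \<in> padic_null p"
      by (intro padic_null_mult) (auto simp: padic_Cauchy_ring_def)
    then show "s \<otimes>\<^bsub>padic_Cauchy_ring p\<^esub> t \<in> padic_null p"
      "t \<otimes>\<^bsub>padic_Cauchy_ring p\<^esub> s \<in> padic_null p"
      by (simp_all add: padic_Cauchy_ring_def mult.commute)
  qed
qed

lemma ring_padic_field: "ring (padic_field p)"
  unfolding padic_field_def by (rule ideal.quotient_is_ring[OF ideal_padic_null])

section \<open>The embedding of the rationals and the norm on its image\<close>

lemma padic_of_rat_closed: "padic_of_rat p q \<in> carrier (padic_field p)"
proof -
  have "(\<lambda>_. q) \<in> carrier (padic_Cauchy_ring p)"
    by (simp add: padic_Cauchy_ring_def padic_Cauchy_const)
  then show ?thesis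
    unfolding padic_field_def padic_of_rat_def
    by (rule ring_hom_closed[OF ideal.rcos_ring_hom[OF ideal_padic_null]])
qed

lemma padic_of_rat_add:
  "padic_of_rat p (q + r) = padic_of_rat p q \<oplus>\<^bsub>padic_field p\<^esub> padic_of_rat p r"
proof -
  have c: "(\<lambda>_. q) \<in> carrier (padic_Cauchy_ring p)" for q
    by (simp add: padic_Cauchy_ring_def padic_Cauchy_const)
  have "(\<lambda>_. q + r) = (\<lambda>_. q) \<oplus>\<^bsub>padic_Cauchy_ring p\<^esub> (\<lambda>_. r)"
    by (simp add: padic_Cauchy_ring_def)
  then show ?thesis
    unfolding padic_field_def padic_of_rat_def
    by (simp only: ring_hom_add[OF ideal.rcos_ring_hom[OF ideal_padic_null] c c])
qed

text \<open>Follows from additivity applied to \<open>q = (q - r) + r\<close> by cancelling in the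
  quotient ring, so negation of cosets need not be computed.\<close>

lemma padic_of_rat_diff:
  "padic_of_rat p (q - r) = padic_of_rat p q \<ominus>\<^bsub>padic_field p\<^esub> padic_of_rat p r"
proof -
  interpret ring "padic_field p"
    by (rule ring_padic_field)
  have "padic_of_rat p q = padic_of_rat p (q - r) \<oplus>\<^bsub>padic_field p\<^esub> padic_of_rat p r"
    using padic_of_rat_add[of "q - r" r] by simp
  then show ?thesis
    by (simp add: padic_of_rat_closed a_minus_def a_assoc r_neg)
qed

lemma padic_of_rat_sum:
  fixes N :: nat
  shows "finsum (padic_field p) (\<lambda>n. padic_of_rat p (f n)) {..<N} = padic_of_rat p (\<Sum>n<N. f n)"
proof -
  interpret ring "padic_field p"
    by (rule ring_padic_field)
  show ?thesis
  proof (induction N)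
    case 0
    \<comment> \<open>The zero coset is reached as the difference of the image of 0 with
      itself.\<close>
    have "padic_of_rat p 0 = \<zero>\<^bsub>padic_field p\<^esub>"
      using padic_of_rat_diff[of 0 0] by (simp add: padic_of_rat_closed r_neg a_minus_def)
    then show ?case
      by simp
  next
    case (Suc N)
    then show ?case
      by (simp add: lessThan_Suc padic_of_rat_closed padic_of_rat_add)
  qed
qed

text \<open>Every representative is a null perturbation of the constant sequence \<open>q\<close>,
  so the reverse triangle inequality gives the same limit for all of them.\<close>

lemma padic_norm_of_rat: "padic_norm p (padic_of_rat p q) = padic_abs p q"
proof -
  have mem: "s \<in> padic_of_rat p q \<longleftrightarrow> (\<exists>h\<in>padic_null p. s = (\<lambda>n. h n + q))" for s
    by (auto simp: padic_of_rat_def a_r_coset_def' padic_Cauchy_ring_def)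
  have lim: "(\<lambda>n. padic_abs p (h n + q)) \<longlonglongrightarrow> padic_abs p q" if "h \<in> padic_null p" for h
  proof -
    have "\<bar>padic_abs p (h n + q) - padic_abs p q\<bar> \<le> padic_abs p (h n)" for n
      using padic_abs_add[of "h n" q] padic_abs_diff[of "h n + q" "h n"] by simp
    moreover have "(\<lambda>n. padic_abs p (h n)) \<longlonglongrightarrow> 0"
      using that by (simp add: padic_null_def)
    ultimately have "(\<lambda>n. padic_abs p (h n + q) - padic_abs p q) \<longlonglongrightarrow> 0"
      by (rule null_comparison[rotated])
    then show ?thesis
      by (simp add: LIM_zero_iff)
  qed
  have "(\<lambda>_. 0) \<in> padic_null p"
    by (simp add: padic_null_def)
  \<comment> \<open>The constant representative makes the class nonempty and pins down the limit; on
    an empty class every \<open>r\<close> would satisfy the description in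
    \<open>padic_norm\<close>.\<close>
  then have const: "(\<lambda>_. q) \<in> padic_of_rat p q"
    unfolding mem by (rule bexI[rotated]) simp
  show ?thesis
    unfolding padic_norm_def
  proof (rule the_equality)
    show "\<forall>s\<in>padic_of_rat p q. (\<lambda>n. padic_abs p (s n)) \<longlonglongrightarrow> padic_abs p q"
      using lim by (auto simp: mem)
  next
    fix r
    assume "\<forall>s\<in>padic_of_rat p q. (\<lambda>n. padic_abs p (s n)) \<longlonglongrightarrow> r"
    from bspec[OF this const] show "r = padic_abs p q"
      by (simp add: LIMSEQ_const_iff)
  qed
qed

text \<open>The error after \<open>N\<close> terms is the image of an integer divisible by
  \<open>fact N\<close>, so its norm is at most that of \<open>fact N\<close>, which tends to 0. The
  divisibility hypothesis does not mention \<open>p\<close>, which is why one integer serves as the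
  sum for all primes.\<close>

lemma padic_sums_of_int_if_fact_dvd:
  assumes "\<And>N. fact N dvd (\<Sum>n<N. f n) - z"
  shows "padic_sums p (\<lambda>n. padic_of_int p (f n)) (padic_of_int p z)"
proof -
  have "padic_norm p (finsum (padic_field p) (\<lambda>n. padic_of_int p (f n)) {..<N}
          \<ominus>\<^bsub>padic_field p\<^esub> padic_of_int p z) = padic_abs p (of_int ((\<Sum>n<N. f n) - z))" for N
    unfolding padic_of_rat_sum padic_of_rat_diff[symmetric] padic_norm_of_rat by simp
  moreover have "(\<lambda>N. padic_abs p (of_int ((\<Sum>n<N. f n) - z))) \<longlonglongrightarrow> 0"
  proof (rule null_comparison[OF padic_abs_fact_tendsto_0])
    show "\<bar>padic_abs p (of_int ((\<Sum>n<N. f n) - z))\<bar> \<le> padic_abs p (fact N)" for N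
      using padic_abs_le_if_dvd[OF assms[of N]] by simp
  qed
  ultimately show ?thesis
    by (simp add: padic_sums_def padic_of_rat_closed)
qed

end

theorem theorem2:
  fixes k :: nat and C :: "nat \<Rightarrow> int" and x :: int
  assumes "k \<ge> 1"
  shows "(\<forall>p::nat. prime p \<longrightarrow>
            padic_sums p (\<lambda>n. padic_of_int p (fact n * P C k n x * x ^ n)) (padic_of_int p (Q C k x)))
       \<and> (\<exists>z::int. \<forall>p::nat. prime p \<longrightarrow>
            padic_sums p (\<lambda>n. padic_of_int p (fact n * P C k n x * x ^ n)) (padic_of_int p z))"
  \<comment> \<open>The witness for the common integer \<open>z\<close> is
    \<open>Q C k x\<close>.\<close>
  using padic_sums_of_int_if_fact_dvd[OF _ fact_dvd_partial_sum_minus_Q] by blast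

end
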